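(* Let $(G,\upsilon,\varepsilon)$ be a weighted multigraph with at least two vertices and let $\lambda_2$ be its second smallest weighted Laplacian eigenvalue (counted with multiplicity). Then $$\frac{\lambda_2}{2}\le\theta_{(G,\upsilon,\varepsilon)}\le\sqrt{2\lambda_2\max_{v\in V}\frac{d_{(G,\varepsilon)}(v)}{\upsilon(v)}}.$$
   Context: A graph is a finite multigraph with vertex set $V$ and edge set $E$ (loops and multiple edges allowed). A weighted multigraph $(G,\upsilon,\varepsilon)$ is a graph $G$ with vertex weights $\upsilon:V\to\mathbb R_{>0}$ and edge weights $\varepsilon:E\to\mathbb R_{>0}$; both are extended additively to subsets (measures). For $u,v\in V$, $\varepsilon(u,v)$ is the total edge weight between $u$ and $v$, with loops counted twice, and $d_{(G,\varepsilon)}(u)=\sum_{v\in V}\varepsilon(u,v)$. The combinatorial Laplacian is the $V\times V$ matrix $L_{(G,\varepsilon)}=D_{(G,\varepsilon)}-A_{(G,\varepsilon)}$, where $A_{(G,\varepsilon)}=(\varepsilon(u,v))_{u,v}$ and $D_{(G,\varepsilon)}$ is diagonal with entries $d_{(G,\varepsilon)}(v)$. The weighted Laplacian is $L_{(G,\upsilon,\varepsilon)}=W_\upsilon^{-1}L_{(G,\varepsilon)}$, where $W_\upsilon$ is the diagonal matrix with entries $\upsilon(v)$; it is self-adjoint for the inner product $\langle f,g\rangle=\sum_{v}f(v)g(v)\upsilon(v)$, with real nonnegative eigenvalues. For $\emptyset\subsetneq S\subsetneq V$, the isoperimetric ratio is $$\theta(S)=\frac{\varepsilon(\nabla S)}{\min\{\upsilon(S),\upsilon(S^c)\}},$$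 where $\nabla S\subseteq E$ is the set of edges with exactly one endpoint in $S$ and $S^c=V\setminus S$. The isoperimetric constant is $\theta_{(G,\upsilon,\varepsilon)}=\min_{\emptyset\subsetneq S\subsetneq V}\theta(S)$. *)

theory Defs
  imports
    "HOL-Analysis.Analysis"
    "HOL-Computational_Algebra.Polynomial"
    "HOL-Library.Multiset"
    "HOL-Library.Uprod"
begin

text \<open>
  The vertex set is a whole finite type, so that \<open>V \<times> V\<close> matrices are Cartesian matrices. The edges
  form a set rather than a type because it may be empty. Each edge has an unordered pair of ends:
  \<open>Upair u u\<close> is a loop at \<open>u\<close>, and distinct edges may share their ends.
\<close>

record ('v, 'e) wmgraph =
  edges :: "'e set"
  ends :: "'e \<Rightarrow> 'v uprod"
  vweight :: "'v \<Rightarrow> real"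
  eweight :: "'e \<Rightarrow> real"

definition weighted_multigraph :: "('v::finite, 'e) wmgraph \<Rightarrow> bool" where
  "weighted_multigraph G \<longleftrightarrow>
     finite (edges G) \<and> (\<forall>v. vweight G v > 0) \<and> (\<forall>e\<in>edges G. eweight G e > 0)"

definition vertex_measure :: "('v::finite, 'e) wmgraph \<Rightarrow> 'v set \<Rightarrow> real" where
  "vertex_measure G S = (\<Sum>v\<in>S. vweight G v)"

definition edge_measure :: "('v::finite, 'e) wmgraph \<Rightarrow> 'e set \<Rightarrow> real" where
  "edge_measure G F = (\<Sum>e\<in>F. eweight G e)"

definition edges_between :: "('v::finite, 'e) wmgraph \<Rightarrow> 'v \<Rightarrow> 'v \<Rightarrow> 'e set" where
  "edges_between G u v = {e \<in> edges G. ends G e = Upair u v}"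

definition adj :: "('v::finite, 'e) wmgraph \<Rightarrow> 'v \<Rightarrow> 'v \<Rightarrow> real" where
  "adj G u v = (if u = v then 2 else 1) * edge_measure G (edges_between G u v)"

definition degree_w :: "('v::finite, 'e) wmgraph \<Rightarrow> 'v \<Rightarrow> real" where
  "degree_w G u = (\<Sum>v\<in>UNIV. adj G u v)"

definition diag_mat :: "('v::finite \<Rightarrow> real) \<Rightarrow> real ^ 'v ^ 'v" where
  "diag_mat f = (\<chi> u v. if u = v then f u else 0)"

definition laplacian :: "('v::finite, 'e) wmgraph \<Rightarrow> real ^ 'v ^ 'v" where
  "laplacian G = diag_mat (degree_w G) - (\<chi> u v. adj G u v)"

definition weighted_laplacian :: "('v::finite, 'e) wmgraph \<Rightarrow> real ^ 'v ^ 'v" where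
  "weighted_laplacian G = matrix_inv (diag_mat (vweight G)) ** laplacian G"

definition charpoly :: "real ^ 'n ^ 'n \<Rightarrow> real poly" where
  "charpoly A = det (\<chi> i j. (if i = j then [:0, 1:] else 0) - [:A $ i $ j:])"

text \<open>
  The real eigenvalues in increasing order, each repeated according to its algebraic multiplicity.
  For the weighted Laplacian of a weighted multigraph all eigenvalues are real, so the list has
  one entry per vertex; it is indexed from \<open>0\<close>.
\<close>

definition eigenvalue_list :: "real ^ 'n ^ 'n \<Rightarrow> real list" where
  "eigenvalue_list A = sorted_list_of_multiset (proots (charpoly A))"

definition lambda2 :: "('v::finite, 'e) wmgraph \<Rightarrow> real" where
  "lambda2 G = eigenvalue_list (weighted_laplacian G) ! 1"

definition edge_boundary :: "('v::finite, 'e) wmgraph \<Rightarrow> 'v set \<Rightarrow> 'e set" where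
  "edge_boundary G S = {e \<in> edges G. \<exists>u\<in>S. \<exists>v\<in>- S. ends G e = Upair u v}"

definition isoperimetric_ratio :: "('v::finite, 'e) wmgraph \<Rightarrow> 'v set \<Rightarrow> real" where
  "isoperimetric_ratio G S =
     edge_measure G (edge_boundary G S) / min (vertex_measure G S) (vertex_measure G (- S))"

definition isoperimetric_constant :: "('v::finite, 'e) wmgraph \<Rightarrow> real" where
  "isoperimetric_constant G = Min (isoperimetric_ratio G ` {S. {} \<subset> S \<and> S \<subset> UNIV})"

end

theory Submission
  imports Defs
begin

text \<open>
  Write \<open>w\<close> for the weighted adjacency matrix, \<open>m\<close> for the vertex weights and \<open>L\<close> for the combinatorial
  Laplacian. The proof is Cheeger's argument, and uses the second eigenvalue only through two facts:
  it is a lower bound for the Rayleigh quotient of every function of weighted mean zero, and it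
  has an eigenfunction of weighted mean zero.

  These facts need an argument because the eigenvalues are given as the roots of the
  characteristic polynomial, with algebraic multiplicity. Conjugating with the square root of \<open>m\<close>
  turns the weighted Laplacian into a symmetric matrix. It has the square root of \<open>m\<close>
  itself in its kernel, and the spectral theorem (\<open>selfadjoint_eigenbasis\<close>) on the orthogonal complement
  of that vector yields a full eigenbasis. The characteristic polynomial therefore splits, its
  roots being \<open>0\<close> and the eigenvalues on the complement, which are nonnegative; the second smallest
  root is the least eigenvalue on the complement (\<open>second_eigenvalue\<close>).

  For the lower bound on the isoperimetric constant, a set \<open>S\<close> is tested by its indicator function
  shifted to mean zero (\<open>cheeger_lower\<close>). For the upper bound, the eigenfunction is cut off at zero,
  with its sign chosen so that the support has at most half of the total measure. This does
  not increase the Rayleigh quotient. All superlevel sets of the truncation \<open>g\<close> then have a cut of at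
  least the isoperimetric constant times their measure; adding these inequalities over the levels of
  \<open>g\<^sup>2\<close> (\<open>coarea_inequality\<close>) and applying the Cauchy--Schwarz inequality gives the bound
  (\<open>cheeger_upper\<close>).
\<close>

section \<open>Orthonormal eigenbases of self-adjoint operators\<close>

text \<open>A minimiser \<open>v\<close> of the quadratic form on the unit sphere of \<open>S\<close> is an eigenvector: moving away
  from \<open>v\<close> along the residual \<open>T v - \<mu> v\<close> would lower the form to first order.\<close>

lemma selfadjoint_has_eigenvector:
  fixes T :: "'a::euclidean_space \<Rightarrow> 'a"
  assumes lin: "linear T" and adj: "\<And>x y. x \<bullet> T y = T x \<bullet> y"
    and sub: "subspace S" and inv: "\<And>x. x \<in> S \<Longrightarrow> T x \<in> S" and ne: "S \<noteq> {0}"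
  obtains v where "v \<in> S" "norm v = 1" "T v = (v \<bullet> T v) *\<^sub>R v"
proof -
  let ?K = "S \<inter> sphere 0 1"
  have comp: "compact ?K"
    by (simp add: closed_Int_compact closed_subspace sub)
  obtain x where x: "x \<in> S" "x \<noteq> 0" using ne sub subspace_0 by blast
  then have "x /\<^sub>R norm x \<in> ?K" by (simp add: sub subspace_scale)
  then have neK: "?K \<noteq> {}" by blast
  have cont: "continuous_on ?K (\<lambda>x. x \<bullet> T x)"
    by (intro continuous_intros linear_continuous_on linear_conv_bounded_linear[THEN iffD1] lin)
  obtain v where v: "v \<in> ?K" and min: "\<And>y. y \<in> ?K \<Longrightarrow> v \<bullet> T v \<le> y \<bullet> T y"
    using continuous_attains_inf[OF comp neK cont] by blast
  define \<mu> where "\<mu> = v \<bullet> T v"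
  define Q where "Q y = y \<bullet> T y - \<mu> * (y \<bullet> y)" for y
  have nv: "v \<in> S" "norm v = 1" "v \<bullet> v = 1" using v by (auto simp: dot_square_norm)
  have Qnn: "Q y \<ge> 0" if "y \<in> S" for y
  proof (cases "y = 0")
    case True then show ?thesis by (simp add: Q_def)
  next
    case False
    then have "y /\<^sub>R norm y \<in> ?K" using that by (simp add: sub subspace_scale)
    from min[OF this] have "\<mu> \<le> (y \<bullet> T y) / (norm y)\<^sup>2"
      by (simp add: \<mu>_def linear_scale[OF lin] power2_eq_square divide_simps)
    then show ?thesis using False
      by (simp add: Q_def dot_square_norm field_simps)
  qed
  define r where "r = T v - \<mu> *\<^sub>R v"
  have rS: "r \<in> S" unfolding r_def by (intro subspace_diff subspace_scale sub inv nv)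
  define c where "c = r \<bullet> r"
  have Qexp: "Q (v + t *\<^sub>R r) = 2 * t * c + t\<^sup>2 * Q r" for t
  proof -
    have a: "v \<bullet> T r = r \<bullet> T v" using adj by (metis inner_commute)
    have b: "r \<bullet> T v = c + \<mu> * (r \<bullet> v)"
      unfolding c_def by (simp add: r_def inner_diff_left inner_diff_right inner_commute algebra_simps)
    show ?thesis
      by (simp add: Q_def linear_add[OF lin] linear_scale[OF lin] inner_add_left inner_add_right a b
          \<mu>_def[symmetric] nv power2_eq_square algebra_simps inner_commute)
  qed
  define q where "q = Q r"
  have q: "q \<ge> 0" unfolding q_def by (rule Qnn[OF rS])
  \<comment> \<open>The parabola \<open>2 t c + t\<^sup>2 q\<close> is negative for small negative \<open>t\<close> unless \<open>c = 0\<close>;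
    the denominator \<open>1 + q\<close> makes this \<open>t\<close> small enough, and covers \<open>q = 0\<close>.\<close>
  have "0 \<le> Q (v + (- c / (1 + q)) *\<^sub>R r)"
    by (intro Qnn subspace_add subspace_scale sub nv rS)
  also have "\<dots> = - (c\<^sup>2 * (2 + q) / (1 + q)\<^sup>2)"
    using q unfolding Qexp q_def[symmetric] by (simp add: divide_simps) (simp add: power2_eq_square algebra_simps)
  finally have "c\<^sup>2 * (2 + q) / (1 + q)\<^sup>2 \<le> 0" by simp
  then have "c\<^sup>2 * (2 + q) \<le> 0" using q by (simp add: divide_le_0_iff)
  then have "c = 0" using q by (simp add: mult_le_0_iff)
  then have "T v = \<mu> *\<^sub>R v" by (simp add: c_def r_def)
  then show ?thesis using that nv \<mu>_def by blast
qed

text \<open>Split off one unit eigenvector \<open>v\<close>. Self-adjointness makes the orthogonal complement of \<open>v\<close> in \<open>S\<close>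
  invariant again, and its dimension is smaller.\<close>

lemma selfadjoint_eigenbasis:
  fixes T :: "'a::euclidean_space \<Rightarrow> 'a"
  assumes lin: "linear T" and adj: "\<And>x y. x \<bullet> T y = T x \<bullet> y"
    and "subspace S" and "\<And>x. x \<in> S \<Longrightarrow> T x \<in> S"
  shows "\<exists>B. B \<subseteq> S \<and> pairwise orthogonal B \<and> (\<forall>b\<in>B. norm b = 1 \<and> T b = (b \<bullet> T b) *\<^sub>R b) \<and> span B = S"
  using assms(3,4)
proof (induction "dim S" arbitrary: S rule: less_induct)
  case less
  show ?case
  proof (cases "S = {0}")
    case True
    then show ?thesis by (intro exI[of _ "{}"]) auto
  next
    case False
    obtain v where v: "v \<in> S" "norm v = 1" "T v = (v \<bullet> T v) *\<^sub>R v"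
      using selfadjoint_has_eigenvector[OF lin adj less.prems False] by blast
    have vv: "v \<bullet> v = 1" using v by (simp add: dot_square_norm)
    define S' where "S' = {x \<in> S. v \<bullet> x = 0}"
    have S': "subspace S'"
      using less.prems(1) by (auto simp: S'_def subspace_def inner_add_right)
    have "v \<notin> S'" using vv by (simp add: S'_def)
    moreover have "S' \<subseteq> S" by (auto simp: S'_def)
    ultimately have "S' \<subset> S" using v(1) by blast
    then have "dim S' < dim S"
      using S' less.prems(1) by (metis dim_psubset span_eq_iff)
    moreover have "T x \<in> S'" if "x \<in> S'" for x
    proof -
      have "v \<bullet> T x = (v \<bullet> T v) * (v \<bullet> x)" using adj v(3) by (metis inner_scaleR_left)
      then show ?thesis using that less.prems(2) by (simp add: S'_def)
    qed
    ultimately obtain B where B: "B \<subseteq> S'" "pairwise orthogonal B"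
      "\<forall>b\<in>B. norm b = 1 \<and> T b = (b \<bullet> T b) *\<^sub>R b" "span B = S'"
      using less.hyps[OF _ S'] by blast
    have "x \<in> span (insert v B)" if "x \<in> S" for x
    proof -
      have "x - (v \<bullet> x) *\<^sub>R v \<in> S'"
        using that less.prems(1) v(1) by (simp add: S'_def subspace_diff subspace_scale inner_diff_right vv)
      then show ?thesis using B(4) span_breakdown_eq by blast
    qed
    moreover have "span (insert v B) \<subseteq> S"
      using B(1) v(1) less.prems(1) by (intro span_minimal) (auto simp: S'_def)
    ultimately have "span (insert v B) = S" by blast
    moreover have "pairwise orthogonal (insert v B)"
      using B(1,2) by (auto simp: pairwise_insert S'_def orthogonal_def inner_commute)
    ultimately show ?thesis
      using B(1,3) v by (intro exI[of _ "insert v B"]) (auto simp: S'_def)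
  qed
qed

lemma orthonormal_expansion:
  fixes B :: "'a::euclidean_space set"
  assumes fin: "finite B" and orth: "pairwise orthogonal B" and norm: "\<And>b. b \<in> B \<Longrightarrow> norm b = 1"
    and x: "x \<in> span B"
  shows "x = (\<Sum>b\<in>B. (b \<bullet> x) *\<^sub>R b)"
proof -
  obtain c where c: "x = (\<Sum>b\<in>B. c b *\<^sub>R b)" using x fin by (auto simp: span_finite)
  have "b \<bullet> x = c b" if b: "b \<in> B" for b
  proof -
    have "b \<bullet> x = (\<Sum>a\<in>B. if a = b then c b else 0)"
      unfolding c inner_sum_right
    proof (rule sum.cong[OF refl])
      fix a assume "a \<in> B"
      then show "b \<bullet> c a *\<^sub>R a = (if a = b then c b else 0)"
        using orth b norm[OF b] by (auto simp: pairwise_def orthogonal_def dot_square_norm)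
    qed
    then show ?thesis using b fin by simp
  qed
  then show ?thesis using c by simp
qed

section \<open>The characteristic polynomial of a diagonalisable matrix\<close>

lemma poly_charpoly: "poly (charpoly A) x = det (\<chi> i j. (if i = j then x else 0) - A $ i $ j)"
proof -
  have *: "(if i = j then x else 0) - A $ i $ j
      = poly ((if i = j then [:0, 1:] else 0) - [:A $ i $ j:]) x" for i j
    by simp
  show ?thesis
    unfolding charpoly_def det_def vec_lambda_beta *
    by (simp add: poly_sum poly_prod poly_of_int)
qed

lemma diag_mat_mult: "diag_mat f ** B = (\<chi> u v. f u * B $ u $ v)"
proof -
  have "(\<Sum>k\<in>UNIV. (if u = k then f u else 0) * B $ k $ v) = (\<Sum>k\<in>UNIV. if u = k then f u * B $ k $ v else 0)" for u v
    by (intro sum.cong) auto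
  then show ?thesis by (simp add: vec_eq_iff matrix_matrix_mult_def diag_mat_def)
qed

lemma mult_diag_mat: "B ** diag_mat f = (\<chi> u v. B $ u $ v * f v)"
proof -
  have "(\<Sum>k\<in>UNIV. B $ u $ k * (if k = v then f k else 0)) = (\<Sum>k\<in>UNIV. if k = v then B $ u $ k * f k else 0)" for u v
    by (intro sum.cong) auto
  then show ?thesis by (simp add: vec_eq_iff matrix_matrix_mult_def diag_mat_def)
qed

text \<open>Both sides are compared as polynomial functions: at each real \<open>x\<close>, the relation \<open>A P = P D\<close> gives
  \<open>(x - A) P = P (x - D)\<close>, and the nonzero factor \<open>det P\<close> cancels from the determinants.\<close>

lemma charpoly_diagonalizable:
  fixes A P :: "real ^ 'n ^ 'n"
  assumes AP: "A ** P = P ** diag_mat d" and P: "det P \<noteq> 0"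
  shows "charpoly A = (\<Prod>i\<in>UNIV. [:- d i, 1:])"
proof -
  have "poly (charpoly A) x = poly (\<Prod>i\<in>UNIV. [:- d i, 1:]) x" for x
  proof -
    have M: "(\<chi> i j. (if i = j then x else 0) - A $ i $ j) = mat x - A"
      by (simp add: vec_eq_iff mat_def)
    have D: "diag_mat (\<lambda>i. x - d i) = mat x - diag_mat d"
      by (simp add: vec_eq_iff mat_def diag_mat_def)
    have mat_x: "mat x = diag_mat (\<lambda>i :: 'n. x)"
      by (simp add: vec_eq_iff mat_def diag_mat_def)
    have comm: "mat x ** P = P ** mat x"
      by (simp add: mat_x diag_mat_mult mult_diag_mat mult.commute)
    have "(mat x - A) ** P = P ** diag_mat (\<lambda>i. x - d i)"
    proof -
      have "(mat x - A) ** P = mat x ** P - A ** P"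
        by (simp add: vec_eq_iff matrix_matrix_mult_def left_diff_distrib sum_subtractf)
      also have "\<dots> = P ** (mat x - diag_mat d)"
        unfolding AP comm by (simp add: vec_eq_iff matrix_matrix_mult_def right_diff_distrib sum_subtractf)
      finally show ?thesis by (simp only: D)
    qed
    then have "det (mat x - A) * det P = det P * det (diag_mat (\<lambda>i. x - d i))"
      by (metis det_mul)
    then have "det (mat x - A) = det (diag_mat (\<lambda>i. x - d i))" using P by simp
    also have "\<dots> = (\<Prod>i\<in>UNIV. x - d i)"
      by (subst det_diagonal) (auto simp: diag_mat_def)
    finally show ?thesis
      by (simp add: poly_charpoly M poly_prod)
  qed
  then show ?thesis using poly_eq_poly_eq_iff by blast
qed

lemma eigenvalue_list_diagonalizable:
  fixes A P :: "real ^ 'n ^ 'n"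
  assumes "A ** P = P ** diag_mat d" and "det P \<noteq> 0"
  shows "eigenvalue_list A = sorted_list_of_multiset (image_mset d (mset_set UNIV))"
  unfolding eigenvalue_list_def charpoly_diagonalizable[OF assms]
  by (simp add: proots_prod sum_unfold_sum_mset)

lemma sorted_list_nth_1:
  fixes a :: "'a::linorder"
  assumes "M \<noteq> {#}" and "\<And>x. x \<in># M \<Longrightarrow> a \<le> x"
  shows "sorted_list_of_multiset (add_mset a M) ! 1 = Min (set_mset M)"
proof -
  let ?l = "sorted_list_of_multiset M"
  have set: "set ?l = set_mset M" by simp
  obtain x xs where l: "?l = x # xs"
    using assms(1) by (metis mset_sorted_list_of_multiset mset_zero_iff neq_Nil_conv)
  have "sorted (x # xs)" by (metis l sorted_sorted_list_of_multiset)
  then have "Min (set_mset M) = x"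
    unfolding set[symmetric] l by (intro Min_eqI) auto
  moreover have "sorted_list_of_multiset (add_mset a M) = a # ?l"
    using assms(2) set by (simp add: insort_is_Cons)
  ultimately show ?thesis by (simp add: l)
qed

section \<open>The variational characterisation of the second eigenvalue\<close>

text \<open>The matrix \<open>A = D\<^sup>-\<^sup>1 L\<close> with \<open>D = diag m\<close> is not symmetric for the
  standard inner product, but it is conjugate by \<open>D\<^sup>1\<^sup>/\<^sup>2\<close> to the symmetric matrix
  \<open>T = D\<^sup>-\<^sup>1\<^sup>/\<^sup>2 L D\<^sup>-\<^sup>1\<^sup>/\<^sup>2\<close>, whose kernel contains \<open>h = D\<^sup>1\<^sup>/\<^sup>2 1\<close>.
  Completing \<open>h\<close> by an orthonormal eigenbasis of its orthogonal complement
  shows that the list of eigenvalues is \<open>0\<close> followed by the eigenvalues on that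
  complement, so the entry at index \<open>1\<close> is the minimum of the latter.\<close>

lemma second_eigenvalue:
  fixes L :: "real ^ 'n ^ 'n" and m :: "'n \<Rightarrow> real"
  assumes m: "\<And>u. m u > 0" and sym: "transpose L = L"
    and ker: "L *v 1 = 0" and psd: "\<And>x. x \<bullet> (L *v x) \<ge> 0"
    and card: "CARD('n) \<ge> 2"
  defines "l \<equiv> eigenvalue_list (\<chi> u v. L $ u $ v / m u) ! 1"
  shows "\<And>f. (\<Sum>u\<in>UNIV. m u * f $ u) = 0 \<Longrightarrow> l * (\<Sum>u\<in>UNIV. m u * (f $ u)\<^sup>2) \<le> f \<bullet> (L *v f)"
    and "\<exists>f. f \<noteq> 0 \<and> (\<Sum>u\<in>UNIV. m u * f $ u) = 0 \<and> (\<forall>u. (L *v f) $ u = l * m u * f $ u)"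
proof -
  let ?A = "\<chi> u v. L $ u $ v / m u"
  define s where "s u = sqrt (m u)" for u
  have s: "s u > 0" "s u * s u = m u" for u using m[of u] by (auto simp: s_def)
  have s0: "s u \<noteq> 0" for u using s(1)[of u] by simp
  define E where "E x = (\<chi> u. x $ u / s u)" for x :: "real ^ 'n"
  define T where "T x = E (L *v (E x))" for x
  define h where "h = (\<chi> u. s u)"
  have E_nth: "E x $ u = x $ u / s u" for x u by (simp add: E_def)
  have linE: "linear E" by (rule linearI) (simp_all add: E_def vec_eq_iff add_divide_distrib)
  have linT: "linear T"
    unfolding T_def using linear_compose[OF linear_compose[OF linE matrix_vector_mul_linear] linE]
    by (simp add: o_def)
  have adjE: "x \<bullet> E y = E x \<bullet> y" for x y by (simp add: inner_vec_def E_nth)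
  have adjL: "x \<bullet> (L *v y) = (L *v x) \<bullet> y" for x y
    by (metis dot_lmul_matrix sym transpose_matrix_vector)
  have adj: "x \<bullet> T y = T x \<bullet> y" for x y by (simp add: T_def adjE adjL)
  have T_form: "x \<bullet> T x = E x \<bullet> (L *v E x)" for x by (simp add: T_def adjE)
  have "E h = 1" using s0 by (simp add: E_def h_def vec_eq_iff)
  then have Th: "T h = 0" using ker linear_0[OF linE] by (simp add: T_def)
  have hh: "h \<noteq> 0" using s0 by (auto simp: h_def vec_eq_iff)
  define S where "S = {x. h \<bullet> x = 0}"
  have subS: "subspace S" unfolding S_def by (rule subspace_hyperplane)
  have "T x \<in> S" for x by (simp add: S_def adj Th)
  then obtain B where B: "B \<subseteq> S" "pairwise orthogonal B"
    "\<And>b. b \<in> B \<Longrightarrow> norm b = 1" "\<And>b. b \<in> B \<Longrightarrow> T b = (b \<bullet> T b) *\<^sub>R b" "span B = S"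
    using selfadjoint_eigenbasis[OF linT adj subS] by blast
  define k where "k = h /\<^sub>R norm h"
  have k: "norm k = 1" "T k = 0" "k \<notin> B"
    using hh B(1) by (auto simp: k_def linear_scale[OF linT] Th S_def)
  let ?C = "insert k B"
  have C_orth: "pairwise orthogonal ?C"
    using B(1,2) by (auto simp: pairwise_insert S_def k_def orthogonal_def inner_commute)
  have C_norm: "norm b = 1" if "b \<in> ?C" for b using that k B by auto
  have C_eig: "T b = (b \<bullet> T b) *\<^sub>R b" if "b \<in> ?C" for b using that k B(4) by auto
  have "0 \<notin> ?C" using C_norm by (metis norm_zero zero_neq_one)
  then have C_ind: "independent ?C" by (intro pairwise_orthogonal_independent C_orth)
  have "x \<in> span ?C" for x
  proof -
    have "x - (h \<bullet> x / norm h) *\<^sub>R k \<in> S"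
      using hh by (simp add: S_def k_def inner_diff_right dot_square_norm power2_eq_square)
    then show ?thesis using B(5) span_breakdown_eq by blast
  qed
  then have C_span: "span ?C = UNIV" by blast
  have finC: "finite ?C" using C_ind by (rule finiteI_independent)
  have "card ?C = CARD('n)"
    using C_ind C_span by (metis DIM_cart DIM_real dim_UNIV dim_eq_card_independent dim_span mult.right_neutral)
  then obtain b where b: "bij_betw b (UNIV :: 'n set) ?C"
    using finC finite_same_card_bij[of "UNIV :: 'n set" ?C] by auto
  have bC: "b i \<in> ?C" for i using b by (auto simp: bij_betw_def)
  have b_dot: "b i \<bullet> b j = (if i = j then 1 else 0)" for i j
  proof (cases "i = j")
    case True then show ?thesis using C_norm[OF bC] by (simp add: dot_square_norm)
  next
    case False
    then have "b i \<noteq> b j" using b by (meson UNIV_I bij_betw_def inj_on_def)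
    then have "orthogonal (b i) (b j)" by (rule pairwiseD[OF C_orth bC bC])
    then show ?thesis using False by (simp add: orthogonal_def)
  qed
  define d where "d x = x \<bullet> T x" for x
  define P where "P = (\<chi> u i. b i $ u / s u)"
  have AP: "?A ** P = P ** diag_mat (d \<circ> b)"
  proof -
    have "(?A ** P) $ u $ i = (P ** diag_mat (d \<circ> b)) $ u $ i" for u i
    proof -
      have "T (b i) $ u = d (b i) * b i $ u" using C_eig[OF bC] by (metis d_def vector_scaleR_component real_scaleR_def)
      then have "(\<Sum>v\<in>UNIV. L $ u $ v * (b i $ v / s v)) = s u * (d (b i) * b i $ u)"
        using s0[of u] by (simp add: T_def E_nth matrix_vector_mult_def field_simps)
      moreover have "(?A ** P) $ u $ i = (\<Sum>v\<in>UNIV. L $ u $ v * (b i $ v / s v)) / m u"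
        by (simp add: matrix_matrix_mult_def P_def sum_divide_distrib mult_ac)
      ultimately have "(?A ** P) $ u $ i = s u * (d (b i) * b i $ u) / m u" by simp
      also have "\<dots> = (P ** diag_mat (d \<circ> b)) $ u $ i"
        using s0[of u] by (simp add: s(2)[symmetric] mult_diag_mat P_def field_simps)
      finally show ?thesis .
    qed
    then show ?thesis by (simp add: vec_eq_iff)
  qed
  have "(\<chi> i u. b i $ u * s u) ** P = mat 1"
    using b_dot s0 by (simp add: vec_eq_iff matrix_matrix_mult_def P_def mat_def inner_vec_def)
  then have "det (\<chi> i u. b i $ u * s u) * det P = 1" by (metis det_I det_mul)
  then have detP: "det P \<noteq> 0" by auto
  have finB: "finite B" using finC by simp
  have "image_mset (d \<circ> b) (mset_set UNIV) = image_mset d (mset_set ?C)"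
    using b by (metis bij_betw_def image_mset_mset_set multiset.map_comp)
  also have "\<dots> = add_mset 0 (image_mset d (mset_set B))"
    using finB k by (simp add: d_def)
  finally have "l = sorted_list_of_multiset (add_mset 0 (image_mset d (mset_set B))) ! 1"
    unfolding l_def eigenvalue_list_diagonalizable[OF AP detP] by simp
  moreover have "B \<noteq> {}" using \<open>card ?C = CARD('n)\<close> card by auto
  moreover have "d x \<ge> 0" for x by (simp add: d_def T_form psd)
  ultimately have l: "l = Min (d ` B)"
    using finB by (subst (asm) sorted_list_nth_1) (auto simp: mset_set_empty_iff)
  \<comment> \<open>A function \<open>f\<close> with weighted mean zero corresponds to \<open>D\<^sup>1\<^sup>/\<^sup>2 f\<close>, a vector orthogonal to \<open>h\<close>.\<close>
  show "l * (\<Sum>u\<in>UNIV. m u * (f $ u)\<^sup>2) \<le> f \<bullet> (L *v f)" if f: "(\<Sum>u\<in>UNIV. m u * f $ u) = 0" for f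
  proof -
    define x where "x = (\<chi> u. s u * f $ u)"
    have Ex: "E x = f" using s0 by (simp add: E_def x_def vec_eq_iff)
    have xx: "x \<bullet> x = (\<Sum>u\<in>UNIV. m u * (f $ u)\<^sup>2)"
      by (simp add: x_def inner_vec_def s(2)[symmetric] power2_eq_square algebra_simps)
    have "x \<in> S" using f by (simp add: S_def x_def h_def inner_vec_def s(2)[symmetric] mult.assoc)
    then have x: "x = (\<Sum>b\<in>B. (b \<bullet> x) *\<^sub>R b)"
      using B by (intro orthonormal_expansion finB) auto
    have "x \<bullet> x = (\<Sum>b\<in>B. (b \<bullet> x) * (b \<bullet> x))"
      by (subst (2) x) (simp add: inner_sum_right inner_commute)
    then have "l * (x \<bullet> x) = (\<Sum>b\<in>B. l * (b \<bullet> x)\<^sup>2)"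
      by (simp add: sum_distrib_left power2_eq_square)
    also have "\<dots> \<le> (\<Sum>b\<in>B. d b * (b \<bullet> x)\<^sup>2)"
      using finB l by (intro sum_mono mult_right_mono) auto
    also have "\<dots> = T x \<bullet> x"
    proof -
      have "T x \<bullet> b = d b * (b \<bullet> x)" if "b \<in> B" for b
      proof -
        have "T x \<bullet> b = x \<bullet> T b" by (simp add: adj)
        also have "\<dots> = x \<bullet> (d b *\<^sub>R b)" using B(4)[OF that] by (simp add: d_def)
        finally show ?thesis by (simp add: inner_commute)
      qed
      then show ?thesis
        by (subst (2) x) (simp add: inner_sum_right power2_eq_square algebra_simps)
    qed
    also have "\<dots> = f \<bullet> (L *v f)" by (simp add: T_form Ex adj[symmetric])
    finally show ?thesis by (simp add: xx)
  qed
  have "l \<in> d ` B" unfolding l using finB \<open>B \<noteq> {}\<close> by (intro Min_in) auto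
  then obtain a where a: "a \<in> B" "d a = l" by blast
  have sE: "s u * E a $ u = a $ u" for u using s0[of u] by (simp add: E_nth)
  have "(\<Sum>u\<in>UNIV. m u * E a $ u) = h \<bullet> a"
    by (simp add: h_def inner_vec_def s(2)[symmetric] mult.assoc sE)
  then have "(\<Sum>u\<in>UNIV. m u * E a $ u) = 0" using a(1) B(1) by (auto simp: S_def)
  moreover have "E a \<noteq> 0"
  proof
    assume "E a = 0"
    then have "a = 0" using sE by (simp add: vec_eq_iff)
    then show False using B(3)[OF a(1)] by simp
  qed
  moreover have "(L *v E a) $ u = l * m u * E a $ u" for u
  proof -
    have "T a $ u = l * a $ u" using B(4)[OF a(1)] a(2) by (metis d_def vector_scaleR_component real_scaleR_def)
    then have "(L *v E a) $ u = s u * (l * a $ u)" using s0[of u] by (simp add: T_def E_nth field_simps)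
    then show ?thesis using sE[of u] by (simp add: s(2)[symmetric])
  qed
  ultimately show "\<exists>f. f \<noteq> 0 \<and> (\<Sum>u\<in>UNIV. m u * f $ u) = 0 \<and> (\<forall>u. (L *v f) $ u = l * m u * f $ u)"
    by blast
qed

section \<open>Cheeger's inequality for symmetric weights\<close>

definition cut_weight :: "('v::finite \<Rightarrow> 'v \<Rightarrow> real) \<Rightarrow> 'v set \<Rightarrow> real" where
  "cut_weight w S = (\<Sum>u\<in>S. \<Sum>v\<in>- S. w u v)"

text \<open>Exchanging the names of \<open>u\<close> and \<open>v\<close> shows that \<open>g u\<close> and \<open>- g v\<close> contribute equally; sums run
  over ordered pairs, whence the factor \<open>2\<close> here and below.\<close>

lemma greens_formula:
  fixes w :: "'v::finite \<Rightarrow> 'v \<Rightarrow> real"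
  assumes sym: "\<And>u v. w u v = w v u"
  shows "(\<Sum>u\<in>UNIV. \<Sum>v\<in>UNIV. w u v * ((g u - g v) * (f u - f v)))
    = 2 * (\<Sum>u\<in>UNIV. g u * (\<Sum>v\<in>UNIV. w u v * (f u - f v)))"
proof -
  have "(\<Sum>u\<in>UNIV. \<Sum>v\<in>UNIV. w u v * (g v * (f v - f u)))
      = (\<Sum>v\<in>UNIV. \<Sum>u\<in>UNIV. w u v * (g v * (f v - f u)))"
    by (rule sum.swap)
  also have "\<dots> = (\<Sum>u\<in>UNIV. \<Sum>v\<in>UNIV. w u v * (g u * (f u - f v)))"
    using sym by (intro sum.cong refl) metis
  finally have swap: "(\<Sum>u\<in>UNIV. \<Sum>v\<in>UNIV. w u v * (g v * (f v - f u)))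
      = (\<Sum>u\<in>UNIV. \<Sum>v\<in>UNIV. w u v * (g u * (f u - f v)))" .
  have "(\<Sum>u\<in>UNIV. \<Sum>v\<in>UNIV. w u v * ((g u - g v) * (f u - f v)))
      = (\<Sum>u\<in>UNIV. \<Sum>v\<in>UNIV. w u v * (g u * (f u - f v)))
      + (\<Sum>u\<in>UNIV. \<Sum>v\<in>UNIV. w u v * (g v * (f v - f u)))"
    unfolding sum.distrib[symmetric] by (intro sum.cong refl) (simp add: algebra_simps)
  also have "\<dots> = 2 * (\<Sum>u\<in>UNIV. g u * (\<Sum>v\<in>UNIV. w u v * (f u - f v)))"
    unfolding swap by (simp add: sum_distrib_left mult_ac)
  finally show ?thesis .
qed

lemma sum_abs_indicator_diff:
  fixes w :: "'v::finite \<Rightarrow> 'v \<Rightarrow> real"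
  assumes sym: "\<And>u v. w u v = w v u"
  shows "(\<Sum>u\<in>UNIV. \<Sum>v\<in>UNIV. w u v * \<bar>indicator S u - indicator S v\<bar>) = 2 * cut_weight w S"
proof -
  have split: "sum F UNIV = sum F S + sum F (- S)" for F :: "'v \<Rightarrow> real"
    by (metis Compl_eq_Diff_UNIV add.commute finite subset_UNIV sum.subset_diff)
  have a: "(\<Sum>v\<in>UNIV. w u v * \<bar>indicator S u - indicator S v\<bar>)
      = (if u \<in> S then \<Sum>v\<in>- S. w u v else \<Sum>v\<in>S. w u v)" for u
    unfolding split by (auto simp: Compl_eq)
  have "(\<Sum>u\<in>- S. \<Sum>v\<in>S. w u v) = (\<Sum>v\<in>S. \<Sum>u\<in>- S. w u v)" by (rule sum.swap)
  also have "\<dots> = cut_weight w S" unfolding cut_weight_def using sym by (intro sum.cong refl) metis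
  finally have "(\<Sum>u\<in>- S. \<Sum>v\<in>S. w u v) = cut_weight w S" .
  then show ?thesis by (simp add: a split[of "\<lambda>u. if u \<in> S then _ u else _ u"] cut_weight_def)
qed

text \<open>A discrete coarea formula. Lowering all positive values of \<open>g\<close> by the smallest of them, \<open>a\<close>,
  shrinks the support \<open>P\<close>, decreases the sum of \<open>m u * g u\<close> by \<open>a\<close> times the measure of \<open>P\<close>, and
  the right-hand side by \<open>a\<close> times twice the cut of \<open>P\<close>. The inequality thus adds up from its instances for the
  indicators of the superlevel sets, all of which lie in \<open>U\<close>.\<close>

lemma coarea_inequality:
  fixes w :: "'v::finite \<Rightarrow> 'v \<Rightarrow> real"
  assumes sym: "\<And>u v. w u v = w v u"
    and small: "\<And>S. S \<subseteq> U \<Longrightarrow> \<theta> * sum m S \<le> cut_weight w S"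
    and nn: "\<And>u. g u \<ge> 0" and supp: "{u. g u > 0} \<subseteq> U"
  shows "2 * \<theta> * (\<Sum>u\<in>UNIV. m u * g u) \<le> (\<Sum>u\<in>UNIV. \<Sum>v\<in>UNIV. w u v * \<bar>g u - g v\<bar>)"
  using nn supp
proof (induction "card {u. g u > 0}" arbitrary: g rule: less_induct)
  case less
  let ?P = "{u. g u > 0}"
  show ?case
  proof (cases "?P = {}")
    case True
    then have "g u = 0" for u using less.prems(1)[of u] by (metis (mono_tags) empty_Collect_eq less_eq_real_def)
    then show ?thesis by simp
  next
    case False
    define a where "a = Min (g ` ?P)"
    have "a \<in> g ` ?P" unfolding a_def using False by (intro Min_in) auto
    then obtain p where p: "g p > 0" "g p = a" by auto
    have a_le: "a \<le> g u" if "g u > 0" for u unfolding a_def using that by (intro Min_le) auto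
    define g' where "g' u = g u - a * indicator ?P u" for u
    have g'nn: "g' u \<ge> 0" for u using a_le less.prems(1) by (auto simp: g'_def indicator_def)
    have "{u. g' u > 0} \<subset> ?P"
      using p less.prems(1) by (auto simp: g'_def indicator_def split: if_splits)
    moreover from this have "card {u. g' u > 0} < card ?P" by (intro psubset_card_mono) auto
    ultimately have IH: "2 * \<theta> * (\<Sum>u\<in>UNIV. m u * g' u) \<le> (\<Sum>u\<in>UNIV. \<Sum>v\<in>UNIV. w u v * \<bar>g' u - g' v\<bar>)"
      using less.hyps[of g'] g'nn less.prems(2) by blast
    have z: "g u = 0" if "\<not> g u > 0" for u using less.prems(1)[of u] that by simp
    have diff: "\<bar>g u - g v\<bar> = \<bar>g' u - g' v\<bar> + a * \<bar>indicator ?P u - indicator ?P v\<bar>" for u v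
      using a_le[of u] a_le[of v] p z[of u] z[of v]
      by (auto simp: g'_def indicator_def)
    have ind: "(\<Sum>u\<in>UNIV. m u * indicator ?P u) = sum m ?P"
      by (simp add: indicator_def if_distrib sum.If_cases cong: if_cong)
    have "2 * \<theta> * (\<Sum>u\<in>UNIV. m u * g u)
        = 2 * \<theta> * (\<Sum>u\<in>UNIV. m u * g' u) + 2 * a * (\<theta> * sum m ?P)"
    proof -
      have "m u * g u = m u * g' u + a * (m u * indicator ?P u)" for u
        by (simp add: g'_def algebra_simps)
      then have "(\<Sum>u\<in>UNIV. m u * g u) = (\<Sum>u\<in>UNIV. m u * g' u) + a * sum m ?P"
        unfolding ind[symmetric] by (simp only: sum.distrib sum_distrib_left)
      then show ?thesis by (simp add: algebra_simps)
    qed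
    also have "\<dots> \<le> (\<Sum>u\<in>UNIV. \<Sum>v\<in>UNIV. w u v * \<bar>g' u - g' v\<bar>) + 2 * a * cut_weight w ?P"
      using p small[OF less.prems(2)] by (intro add_mono IH mult_left_mono) auto
    also have "2 * a * cut_weight w ?P = a * (\<Sum>u\<in>UNIV. \<Sum>v\<in>UNIV. w u v * \<bar>indicator ?P u - indicator ?P v\<bar>)"
      using sum_abs_indicator_diff[of w ?P, OF sym] by simp
    also have "(\<Sum>u\<in>UNIV. \<Sum>v\<in>UNIV. w u v * \<bar>g' u - g' v\<bar>) + \<dots>
        = (\<Sum>u\<in>UNIV. \<Sum>v\<in>UNIV. w u v * \<bar>g u - g v\<bar>)"
      unfolding diff by (simp add: sum_distrib_left sum.distrib algebra_simps)
    finally show ?thesis .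
  qed
qed

lemma signless_form_le:
  fixes w :: "'v::finite \<Rightarrow> 'v \<Rightarrow> real"
  assumes sym: "\<And>u v. w u v = w v u" and wnn: "\<And>u v. w u v \<ge> 0"
    and deg: "\<And>u. (\<Sum>v\<in>UNIV. w u v) \<le> M * m u"
  shows "(\<Sum>u\<in>UNIV. \<Sum>v\<in>UNIV. w u v * (g u + g v)\<^sup>2) \<le> 4 * M * (\<Sum>u\<in>UNIV. m u * (g u)\<^sup>2)"
proof -
  have swap: "(\<Sum>u\<in>UNIV. \<Sum>v\<in>UNIV. w u v * (g v)\<^sup>2) = (\<Sum>u\<in>UNIV. \<Sum>v\<in>UNIV. w u v * (g u)\<^sup>2)"
    by (subst sum.swap) (use sym in \<open>intro sum.cong refl; metis\<close>)
  have "(\<Sum>u\<in>UNIV. \<Sum>v\<in>UNIV. w u v * (g u + g v)\<^sup>2)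
      \<le> (\<Sum>u\<in>UNIV. \<Sum>v\<in>UNIV. w u v * (2 * (g u)\<^sup>2 + 2 * (g v)\<^sup>2))"
  proof (intro sum_mono mult_left_mono wnn)
    show "(g u + g v)\<^sup>2 \<le> 2 * (g u)\<^sup>2 + 2 * (g v)\<^sup>2" for u v
      using sum_squares_bound[of "g u" "g v"] by (simp add: power2_sum)
  qed
  also have "\<dots> = 2 * (\<Sum>u\<in>UNIV. \<Sum>v\<in>UNIV. w u v * (g u)\<^sup>2) + 2 * (\<Sum>u\<in>UNIV. \<Sum>v\<in>UNIV. w u v * (g v)\<^sup>2)"
    by (simp add: sum.distrib sum_distrib_left algebra_simps)
  also have "\<dots> = 4 * (\<Sum>u\<in>UNIV. (\<Sum>v\<in>UNIV. w u v) * (g u)\<^sup>2)"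
    unfolding swap by (simp add: sum_distrib_right)
  also have "\<dots> \<le> 4 * (\<Sum>u\<in>UNIV. (M * m u) * (g u)\<^sup>2)"
    using deg by (intro mult_left_mono sum_mono mult_right_mono) auto
  finally show ?thesis by (simp add: sum_distrib_left mult_ac)
qed

lemma Cauchy_Schwarz_double_sum:
  fixes w :: "'v::finite \<Rightarrow> 'v \<Rightarrow> real"
  assumes wnn: "\<And>u v. w u v \<ge> 0"
  shows "(\<Sum>u\<in>UNIV. \<Sum>v\<in>UNIV. w u v * \<bar>(g u)\<^sup>2 - (g v)\<^sup>2\<bar>)\<^sup>2
    \<le> (\<Sum>u\<in>UNIV. \<Sum>v\<in>UNIV. w u v * (g u - g v)\<^sup>2) * (\<Sum>u\<in>UNIV. \<Sum>v\<in>UNIV. w u v * (g u + g v)\<^sup>2)"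
proof -
  have total: "(\<Sum>i\<in>UNIV \<times> UNIV. F i) = (\<Sum>u\<in>UNIV. \<Sum>v\<in>UNIV. F (u, v))" for F :: "'v \<times> 'v \<Rightarrow> real"
    by (simp add: sum.cartesian_product del: UNIV_Times_UNIV)
  define a where "a = (\<lambda>(u, v). sqrt (w u v) * \<bar>g u - g v\<bar>)"
  define b where "b = (\<lambda>(u, v). sqrt (w u v) * \<bar>g u + g v\<bar>)"
  have "a (u, v) * b (u, v) = w u v * \<bar>(g u)\<^sup>2 - (g v)\<^sup>2\<bar>"
    "(a (u, v))\<^sup>2 = w u v * (g u - g v)\<^sup>2" "(b (u, v))\<^sup>2 = w u v * (g u + g v)\<^sup>2" for u v
  proof -
    have "a (u, v) * b (u, v) = (sqrt (w u v))\<^sup>2 * \<bar>(g u - g v) * (g u + g v)\<bar>"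
      by (simp add: a_def b_def abs_mult power2_eq_square)
    moreover have "(g u - g v) * (g u + g v) = (g u)\<^sup>2 - (g v)\<^sup>2"
      by (simp add: power2_eq_square algebra_simps)
    ultimately show "a (u, v) * b (u, v) = w u v * \<bar>(g u)\<^sup>2 - (g v)\<^sup>2\<bar>" using wnn by simp
  qed (use wnn in \<open>simp_all add: a_def b_def power_mult_distrib\<close>)
  then show ?thesis
    using Cauchy_Schwarz_ineq_sum[of a b "UNIV \<times> UNIV"]
    by (simp add: total del: UNIV_Times_UNIV)
qed

text \<open>Truncation to \<open>g = max f 0\<close> satisfies \<open>(g u - g v)\<^sup>2 \<le> (g u - g v) (f u - f v)\<close>, so Green's
  formula and the eigenvalue equation bound the energy of \<open>g\<close> by \<open>l\<close> times its squared norm \<open>n\<close>. The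
  coarea inequality applied to \<open>g\<^sup>2\<close> instead of \<open>g\<close> bounds \<open>n\<close> by the sum of
  \<open>w u v * \<bar>(g u)\<^sup>2 - (g v)\<^sup>2\<bar>\<close>, and factoring the difference of squares leaves, by
  Cauchy--Schwarz, the energy and a second form that is controlled by the degrees.\<close>

lemma cheeger_positive_part:
  fixes w :: "'v::finite \<Rightarrow> 'v \<Rightarrow> real"
  assumes sym: "\<And>u v. w u v = w v u" and wnn: "\<And>u v. w u v \<ge> 0" and m: "\<And>u. m u > 0"
    and deg: "\<And>u. (\<Sum>v\<in>UNIV. w u v) \<le> M * m u"
    and eig: "\<And>u. (\<Sum>v\<in>UNIV. w u v * (f u - f v)) = l * m u * f u"
    and pos: "f p > 0" and \<theta>: "\<theta> \<ge> 0"
    and small: "\<And>S. S \<subseteq> {u. f u > 0} \<Longrightarrow> \<theta> * sum m S \<le> cut_weight w S"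
  shows "\<theta>\<^sup>2 \<le> 2 * l * M"
proof -
  define g where "g u = max (f u) 0" for u
  define n where "n = (\<Sum>u\<in>UNIV. m u * (g u)\<^sup>2)"
  let ?E = "\<Sum>u\<in>UNIV. \<Sum>v\<in>UNIV. w u v * (g u - g v)\<^sup>2"
  let ?F = "\<Sum>u\<in>UNIV. \<Sum>v\<in>UNIV. w u v * \<bar>(g u)\<^sup>2 - (g v)\<^sup>2\<bar>"
  let ?H = "\<Sum>u\<in>UNIV. \<Sum>v\<in>UNIV. w u v * (g u + g v)\<^sup>2"
  have mn: "m u \<ge> 0" for u using m[of u] by simp
  have "0 < m p * (g p)\<^sup>2" using m pos by (simp add: g_def)
  also have "\<dots> \<le> n" unfolding n_def using mn by (intro member_le_sum) auto
  finally have n: "n > 0" .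
  have gf: "g u * f u = (g u)\<^sup>2" for u by (auto simp: g_def max_def power2_eq_square)
  have "?E \<le> (\<Sum>u\<in>UNIV. \<Sum>v\<in>UNIV. w u v * ((g u - g v) * (f u - f v)))"
  proof (intro sum_mono mult_left_mono wnn)
    fix u v
    have le: "g u * f v \<le> g u * g v" "g v * f u \<le> g v * g u"
      by (simp_all add: g_def mult_left_mono)
    show "(g u - g v)\<^sup>2 \<le> (g u - g v) * (f u - f v)"
    proof -
      have "(g u - g v) * (f u - f v) - (g u - g v)\<^sup>2
          = (g u * f u - (g u)\<^sup>2) + (g v * f v - (g v)\<^sup>2)
            + (g u * g v - g u * f v) + (g v * g u - g v * f u)"
        by (simp add: power2_eq_square algebra_simps)
      then show ?thesis
        using le gf[of u] gf[of v] by linarith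
    qed
  qed
  also have "\<dots> = 2 * (\<Sum>u\<in>UNIV. g u * (l * m u * f u))"
    by (simp add: greens_formula[OF sym] eig)
  also have "(\<Sum>u\<in>UNIV. g u * (l * m u * f u)) = (\<Sum>u\<in>UNIV. l * (m u * (g u)\<^sup>2))"
    by (simp add: gf[symmetric] mult_ac)
  also have "2 * \<dots> = 2 * l * n" by (simp add: n_def sum_distrib_left mult_ac)
  finally have E: "?E \<le> 2 * l * n" .
  have H: "?H \<le> 4 * M * n" unfolding n_def by (rule signless_form_le[OF sym wnn deg])
  have supp: "{u. (g u)\<^sup>2 > 0} \<subseteq> {u. f u > 0}" by (auto simp: g_def)
  have "2 * \<theta> * n \<le> ?F"
    unfolding n_def by (rule coarea_inequality[OF sym small _ supp]) auto
  then have "(2 * \<theta> * n)\<^sup>2 \<le> ?F\<^sup>2" using \<theta> n by (intro power_mono) auto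
  also have "\<dots> \<le> ?E * ?H" by (rule Cauchy_Schwarz_double_sum[OF wnn])
  also have "\<dots> \<le> (2 * l * n) * (4 * M * n)"
    using E H wnn by (intro mult_mono' sum_nonneg) auto
  finally have "\<theta>\<^sup>2 * (4 * n\<^sup>2) \<le> (2 * l * M) * (4 * n\<^sup>2)" by (simp add: power2_eq_square algebra_simps)
  then show ?thesis using n by (simp add: mult_ac)
qed

text \<open>An eigenfunction of weighted mean zero takes both signs, and at least one of the sets where it
  is positive or negative has at most half of the total measure. After a change of sign this is
  the positive one, and for its subsets \<open>S\<close> the minimum in the isoperimetric ratio is the measure of \<open>S\<close>.\<close>

lemma cheeger_upper:
  fixes w :: "'v::finite \<Rightarrow> 'v \<Rightarrow> real"
  assumes sym: "\<And>u v. w u v = w v u" and wnn: "\<And>u v. w u v \<ge> 0" and m: "\<And>u. m u > 0"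
    and deg: "\<And>u. (\<Sum>v\<in>UNIV. w u v) \<le> M * m u"
    and eig: "\<And>u. (\<Sum>v\<in>UNIV. w u v * (f u - f v)) = l * m u * f u"
    and mean: "(\<Sum>u\<in>UNIV. m u * f u) = 0" and nz: "f q \<noteq> 0" and \<theta>: "\<theta> \<ge> 0"
    and iso: "\<And>S. \<theta> * min (sum m S) (sum m (- S)) \<le> cut_weight w S"
  shows "\<theta>\<^sup>2 \<le> 2 * l * M"
proof -
  have wlog: "\<theta>\<^sup>2 \<le> 2 * l * M"
    if eig: "\<And>u. (\<Sum>v\<in>UNIV. w u v * (f u - f v)) = l * m u * f u"
    and mean: "(\<Sum>u\<in>UNIV. m u * f u) = 0" and nz: "f q \<noteq> 0"
    and le: "sum m {u. f u > 0} \<le> sum m {u. f u < 0}" for f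
  proof -
    have "\<exists>p. f p > 0"
    proof (rule ccontr)
      assume "\<nexists>p. f p > 0"
      then have np: "f u \<le> 0" for u by (simp add: not_less)
      then have "m u * - f u \<ge> 0" for u using m[of u] by (intro mult_nonneg_nonneg) auto
      moreover have "(\<Sum>u\<in>UNIV. m u * - f u) = 0" using mean by (simp add: sum_negf)
      ultimately have "m q * - f q = 0" using sum_nonneg_eq_0_iff[of UNIV "\<lambda>u. m u * - f u"] by simp
      then show False using nz m[of q] by simp
    qed
    then obtain p where p: "f p > 0" by blast
    have small: "\<theta> * sum m S \<le> cut_weight w S" if S: "S \<subseteq> {u. f u > 0}" for S
    proof -
      have mono: "sum m A \<le> sum m B" if "A \<subseteq> B" for A B
        using that m by (intro sum_mono2) (auto intro: less_imp_le)
      have "sum m S \<le> sum m {u. f u > 0}" by (rule mono[OF S])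
      also note le
      also have "sum m {u. f u < 0} \<le> sum m (- S)" using S by (intro mono) auto
      finally show ?thesis using iso[of S] by simp
    qed
    show ?thesis by (rule cheeger_positive_part[OF sym wnn m deg eig p \<theta> small])
  qed
  show ?thesis
  proof (cases "sum m {u. f u > 0} \<le> sum m {u. f u < 0}")
    case True
    show ?thesis by (rule wlog[OF eig mean nz True])
  next
    case False
    have "(\<Sum>v\<in>UNIV. w u v * ((- f u) - (- f v))) = l * m u * (- f u)" for u
    proof -
      have "(\<Sum>v\<in>UNIV. w u v * ((- f u) - (- f v))) = - (\<Sum>v\<in>UNIV. w u v * (f u - f v))"
        by (simp add: sum_negf[symmetric] algebra_simps)
      then show ?thesis by (simp add: eig)
    qed
    then show ?thesis
      using mean nz False by (intro wlog[of "\<lambda>u. - f u"]) (auto simp: sum_negf)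
  qed
qed

text \<open>The test function is the indicator of \<open>S\<close>, shifted to mean zero and scaled: it is \<open>b\<close> on \<open>S\<close> and
  \<open>- a\<close> elsewhere, where \<open>a\<close> and \<open>b\<close> are the measures of \<open>S\<close> and of its complement. Its Rayleigh
  quotient is the cut times \<open>(a + b) / (a b)\<close>, which is at most \<open>2 / min a b\<close>.\<close>

lemma cheeger_lower:
  fixes w :: "'v::finite \<Rightarrow> 'v \<Rightarrow> real"
  assumes sym: "\<And>u v. w u v = w v u" and wnn: "\<And>u v. w u v \<ge> 0" and m: "\<And>u. m u > 0"
    and var: "\<And>f. (\<Sum>u\<in>UNIV. m u * f u) = 0 \<Longrightarrow>
      2 * l * (\<Sum>u\<in>UNIV. m u * (f u)\<^sup>2) \<le> (\<Sum>u\<in>UNIV. \<Sum>v\<in>UNIV. w u v * (f u - f v)\<^sup>2)"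
    and S: "S \<noteq> {}" "S \<noteq> UNIV"
  shows "l / 2 \<le> cut_weight w S / min (sum m S) (sum m (- S))"
proof -
  define a where "a = sum m S"
  define b where "b = sum m (- S)"
  have a: "a > 0" unfolding a_def using S m by (intro sum_pos) auto
  have b: "b > 0" unfolding b_def using S m by (intro sum_pos) auto
  have split: "sum F UNIV = sum F S + sum F (- S)" for F :: "'v \<Rightarrow> real"
    by (metis Compl_eq_Diff_UNIV add.commute finite subset_UNIV sum.subset_diff)
  have cut0: "cut_weight w S \<ge> 0" unfolding cut_weight_def by (intro sum_nonneg wnn)
  define f where "f u = (a + b) * indicator S u - a" for u :: 'v
  have fS: "f u = b" if "u \<in> S" for u using that by (simp add: f_def)
  have fC: "f u = - a" if "u \<in> - S" for u using that by (simp add: f_def)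
  have "(\<Sum>u\<in>UNIV. m u * f u) = a * b + b * (- a)"
    unfolding split a_def b_def sum_distrib_right
    by (simp add: fS fC a_def b_def)
  then have mean: "(\<Sum>u\<in>UNIV. m u * f u) = 0" by simp
  have "(\<Sum>u\<in>UNIV. m u * (f u)\<^sup>2) = a * b\<^sup>2 + b * a\<^sup>2"
    unfolding split a_def b_def sum_distrib_right
    by (simp add: fS fC a_def b_def)
  then have sq: "(\<Sum>u\<in>UNIV. m u * (f u)\<^sup>2) = a * b * (a + b)" by (simp add: power2_eq_square algebra_simps)
  have "(f u - f v)\<^sup>2 = (a + b)\<^sup>2 * \<bar>indicator S u - indicator S v\<bar>" for u v
    by (auto simp: f_def indicator_def power2_eq_square algebra_simps)
  then have "(\<Sum>u\<in>UNIV. \<Sum>v\<in>UNIV. w u v * (f u - f v)\<^sup>2)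
      = (a + b)\<^sup>2 * (\<Sum>u\<in>UNIV. \<Sum>v\<in>UNIV. w u v * \<bar>indicator S u - indicator S v\<bar>)"
    by (simp add: sum_distrib_left mult_ac)
  also have "\<dots> = 2 * (a + b)\<^sup>2 * cut_weight w S"
    by (simp add: sum_abs_indicator_diff[OF sym])
  finally have "2 * l * (a * b * (a + b)) \<le> 2 * (a + b)\<^sup>2 * cut_weight w S"
    using var[OF mean] sq by simp
  then have "(2 * (a + b)) * (l * (a * b)) \<le> (2 * (a + b)) * ((a + b) * cut_weight w S)"
    by (simp add: power2_eq_square algebra_simps)
  then have "l * (a * b) \<le> (a + b) * cut_weight w S" using a b by simp
  also have "\<dots> \<le> (2 * max a b) * cut_weight w S" by (intro mult_right_mono cut0) auto
  finally have "(l * min a b) * max a b \<le> (2 * cut_weight w S) * max a b"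
    by (simp add: min_def max_def mult_ac split: if_splits)
  then have "l * min a b \<le> 2 * cut_weight w S" using a by (simp add: max_def split: if_splits)
  then show ?thesis using a b unfolding a_def[symmetric] b_def[symmetric] by (simp add: field_simps)
qed

section \<open>Weighted multigraphs\<close>

lemma adj_commute: "adj G u v = adj G v u"
proof -
  have "edges_between G u v = edges_between G v u" by (auto simp: edges_between_def)
  then show ?thesis by (auto simp: adj_def)
qed

lemma adj_nonneg: "weighted_multigraph G \<Longrightarrow> adj G u v \<ge> 0"
  unfolding adj_def edge_measure_def weighted_multigraph_def edges_between_def
  by (intro mult_nonneg_nonneg sum_nonneg) (auto intro: less_imp_le)

text \<open>Every boundary edge is counted once, by the ordered pair whose first component is its end in \<open>S\<close>.
  The components of such a pair differ, so its adjacency entry is the plain total weight of the edges.\<close>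

lemma edge_measure_boundary:
  assumes "weighted_multigraph G"
  shows "edge_measure G (edge_boundary G S) = cut_weight (adj G) S"
proof -
  have fin: "finite (edges_between G u v)" for u v
    using assms by (simp add: weighted_multigraph_def edges_between_def)
  have U: "edge_boundary G S = (\<Union>(u, v)\<in>S \<times> - S. edges_between G u v)"
    by (auto simp: edge_boundary_def edges_between_def)
  have "edge_measure G (edge_boundary G S) = (\<Sum>(u, v)\<in>S \<times> - S. edge_measure G (edges_between G u v))"
    unfolding edge_measure_def U
    by (subst sum.UNION_disjoint) (use fin in \<open>auto simp: edges_between_def case_prod_beta\<close>)
  also have "\<dots> = (\<Sum>(u, v)\<in>S \<times> - S. adj G u v)"
    by (intro sum.cong) (auto simp: adj_def)
  finally show ?thesis by (simp add: cut_weight_def sum.cartesian_product)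
qed

lemma laplacian_mult_vec:
  "(laplacian G *v f) $ u = (\<Sum>v\<in>UNIV. adj G u v * (f $ u - f $ v))"
proof -
  have "(laplacian G *v f) $ u = (\<Sum>v\<in>UNIV. (if u = v then degree_w G u * f $ v else 0) - adj G u v * f $ v)"
    unfolding laplacian_def diag_mat_def matrix_vector_mult_def
    by (auto intro!: sum.cong simp: algebra_simps)
  then show ?thesis
    by (simp add: sum_subtractf degree_w_def sum_distrib_right right_diff_distrib)
qed

lemma weighted_laplacian_eq:
  assumes "weighted_multigraph G"
  shows "weighted_laplacian G = (\<chi> u v. laplacian G $ u $ v / vweight G u)"
proof -
  have nz: "vweight G v \<noteq> 0" for v
    using assms by (metis weighted_multigraph_def less_irrefl)
  let ?D = "diag_mat (vweight G)" and ?I = "diag_mat (\<lambda>v. 1 / vweight G v)"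
  have "?D ** ?I = mat 1" "?I ** ?D = mat 1"
    unfolding diag_mat_mult using nz by (auto simp: vec_eq_iff diag_mat_def mat_def)
  then have "?D ** matrix_inv ?D = mat 1"
    unfolding matrix_inv_def by (metis (mono_tags, lifting) someI_ex)
  with \<open>?I ** ?D = mat 1\<close> have inv: "matrix_inv ?D = ?I"
    by (metis matrix_mul_assoc matrix_mul_lid matrix_mul_rid)
  show ?thesis
    unfolding weighted_laplacian_def inv
    by (simp add: diag_mat_mult)
qed

lemma laplacian_quadratic_form:
  "2 * (f \<bullet> (laplacian G *v f)) = (\<Sum>u\<in>UNIV. \<Sum>v\<in>UNIV. adj G u v * (f $ u - f $ v)\<^sup>2)"
  using greens_formula[of "adj G" "\<lambda>u. f $ u" "\<lambda>u. f $ u", OF adj_commute]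
  by (simp add: inner_vec_def laplacian_mult_vec power2_eq_square)

lemma transpose_laplacian: "transpose (laplacian G) = laplacian G"
  by (auto simp: vec_eq_iff transpose_def laplacian_def diag_mat_def adj_commute[of G])

lemma lambda2_characterization:
  fixes G :: "('v::finite, 'e) wmgraph"
  assumes G: "weighted_multigraph G" and card: "CARD('v) \<ge> 2"
  shows lambda2_le: "\<And>f. (\<Sum>u\<in>UNIV. vweight G u * f u) = 0 \<Longrightarrow>
      2 * lambda2 G * (\<Sum>u\<in>UNIV. vweight G u * (f u)\<^sup>2)
        \<le> (\<Sum>u\<in>UNIV. \<Sum>v\<in>UNIV. adj G u v * (f u - f v)\<^sup>2)"
    and lambda2_eigenfunction: "\<exists>f q. f q \<noteq> 0 \<and> (\<Sum>u\<in>UNIV. vweight G u * f u) = 0 \<and>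
      (\<forall>u. (\<Sum>v\<in>UNIV. adj G u v * (f u - f v)) = lambda2 G * vweight G u * f u)"
proof -
  have m: "vweight G u > 0" for u using G by (simp add: weighted_multigraph_def)
  have ker: "laplacian G *v 1 = 0" by (simp add: vec_eq_iff laplacian_mult_vec)
  have psd: "x \<bullet> (laplacian G *v x) \<ge> 0" for x
  proof -
    have "(\<Sum>u\<in>UNIV. \<Sum>v\<in>UNIV. adj G u v * (x $ u - x $ v)\<^sup>2) \<ge> 0"
      by (intro sum_nonneg mult_nonneg_nonneg adj_nonneg G) auto
    then show ?thesis using laplacian_quadratic_form[of x G] by simp
  qed
  have l: "lambda2 G = eigenvalue_list (\<chi> u v. laplacian G $ u $ v / vweight G u) ! 1"
    by (simp add: lambda2_def weighted_laplacian_eq[OF G])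
  note second = second_eigenvalue[of "vweight G", OF m transpose_laplacian ker psd card, folded l]
  show "2 * lambda2 G * (\<Sum>u\<in>UNIV. vweight G u * (f u)\<^sup>2)
        \<le> (\<Sum>u\<in>UNIV. \<Sum>v\<in>UNIV. adj G u v * (f u - f v)\<^sup>2)"
    if "(\<Sum>u\<in>UNIV. vweight G u * f u) = 0" for f
    using second(1)[where f = "\<chi> u. f u"] that laplacian_quadratic_form[of "\<chi> u. f u" G] by simp
  obtain f where f: "f \<noteq> 0" "(\<Sum>u\<in>UNIV. vweight G u * f $ u) = 0"
    "\<forall>u. (laplacian G *v f) $ u = lambda2 G * vweight G u * f $ u"
    using second(2) by blast
  then obtain q where "f $ q \<noteq> 0" by (auto simp: vec_eq_iff)
  then show "\<exists>f q. f q \<noteq> 0 \<and> (\<Sum>u\<in>UNIV. vweight G u * f u) = 0 \<and>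
      (\<forall>u. (\<Sum>v\<in>UNIV. adj G u v * (f u - f v)) = lambda2 G * vweight G u * f u)"
    using f by (intro exI[of _ "\<lambda>u. f $ u"] exI[of _ q]) (simp add: laplacian_mult_vec)
qed

theorem corollary7p2:
  fixes G :: "('v::finite, 'e) wmgraph"
  assumes "weighted_multigraph G"
    and "CARD('v) \<ge> 2"
  shows "lambda2 G / 2 \<le> isoperimetric_constant G \<and>
    isoperimetric_constant G \<le> sqrt (2 * lambda2 G * (MAX v. degree_w G v / vweight G v))"
proof -
  let ?w = "adj G" and ?m = "vweight G" and ?\<theta> = "isoperimetric_constant G"
  let ?M = "MAX v. degree_w G v / vweight G v"
  let ?F = "{S :: 'v set. {} \<subset> S \<and> S \<subset> UNIV}"
  have m: "?m u > 0" for u using assms(1) by (simp add: weighted_multigraph_def)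
  note wnn = adj_nonneg[OF assms(1)]
  have ratio: "isoperimetric_ratio G S = cut_weight ?w S / min (sum ?m S) (sum ?m (- S))" for S
    by (simp add: isoperimetric_ratio_def edge_measure_boundary[OF assms(1)] vertex_measure_def)
  have "{undefined} \<noteq> (UNIV :: 'v set)"
  proof
    assume "{undefined} = (UNIV :: 'v set)"
    then have "CARD('v) = card {undefined :: 'v}" by simp
    then show False using assms(2) by simp
  qed
  then have "{undefined} \<in> ?F" by blast
  then have ne: "isoperimetric_ratio G ` ?F \<noteq> {}" by blast
  have fin: "finite (isoperimetric_ratio G ` ?F)" by simp
  have "lambda2 G / 2 \<le> isoperimetric_ratio G S" if "S \<in> ?F" for S
    unfolding ratio using that by (intro cheeger_lower[OF adj_commute wnn m lambda2_le[OF assms]]) auto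
  then have lower: "lambda2 G / 2 \<le> ?\<theta>"
    unfolding isoperimetric_constant_def by (intro Min.boundedI fin ne) auto
  have mpos: "0 < sum ?m S" if "S \<noteq> {}" for S
    using that m by (intro sum_pos) auto
  have cut0: "0 \<le> cut_weight ?w S" for S unfolding cut_weight_def by (intro sum_nonneg wnn)
  have "?\<theta> \<in> isoperimetric_ratio G ` ?F"
    unfolding isoperimetric_constant_def by (rule Min_in[OF fin ne])
  then have \<theta>: "?\<theta> \<ge> 0"
    using mpos cut0 by (auto simp: ratio intro!: divide_nonneg_nonneg sum_nonneg less_imp_le[OF m])
  \<comment> \<open>Admitting the two trivial sets is harmless, as the minimum is \<open>0\<close> for them, and spares the
    coarea argument any case distinction.\<close>
  have iso: "?\<theta> * min (sum ?m S) (sum ?m (- S)) \<le> cut_weight ?w S" for S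
  proof (cases "S \<in> ?F")
    case True
    then have "?\<theta> \<le> isoperimetric_ratio G S"
      unfolding isoperimetric_constant_def by (intro Min_le fin) auto
    moreover have "0 < min (sum ?m S) (sum ?m (- S))" using True mpos[of S] mpos[of "- S"] by auto
    ultimately show ?thesis by (simp add: ratio field_simps)
  next
    case False
    then have "S = {} \<or> S = UNIV" by blast
    moreover have "0 \<le> sum ?m S" for S by (intro sum_nonneg less_imp_le[OF m])
    ultimately have "min (sum ?m S) (sum ?m (- S)) = 0" by (auto simp: min_absorb1 min_absorb2)
    then show ?thesis using cut0 by simp
  qed
  have deg: "(\<Sum>v\<in>UNIV. ?w u v) \<le> ?M * ?m u" for u
  proof -
    have "degree_w G u / ?m u \<le> ?M" by (intro Max_ge) auto
    then show ?thesis using m[of u] by (simp add: degree_w_def field_simps)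
  qed
  obtain f q where f: "f q \<noteq> 0" "(\<Sum>u\<in>UNIV. ?m u * f u) = 0"
    "\<And>u. (\<Sum>v\<in>UNIV. ?w u v * (f u - f v)) = lambda2 G * ?m u * f u"
    using lambda2_eigenfunction[OF assms] by blast
  have "?\<theta>\<^sup>2 \<le> 2 * lambda2 G * ?M"
    by (rule cheeger_upper[OF adj_commute wnn m deg f(3,2,1) \<theta> iso])
  then show ?thesis using lower real_le_rsqrt by blast
qed

end
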